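(* Let $\Delta ABC$ be a (nondegenerate) triangle in the two-dimensional Euclidean plane, let $O$ be the center and $R$ the radius of the circumcircle of $\Delta ABC$, and let $K$ be a point of the plane. If $\Delta TUV$ is the antipedal triangle of the point $K$ with respect to $\Delta ABC$, and $K_1$ is the isogonal of $K$ for the triangle $ABC$, then $$\frac{|\Delta TUV|}{|\Delta ABC|}=\frac{4R^2}{|R^2-OK_1^2|}.$$
   Context: All points lie in a two-dimensional Euclidean plane. $|\Delta XYZ|$ denotes the (unsigned) area of the triangle $XYZ$, and $OK_1$ denotes the distance from $O$ to $K_1$. Antipedal triangle: a (nondegenerate) triangle $TUV$ is called the antipedal triangle of a point $K$ with respect to $\Delta ABC$ if the lines $KA$, $KB$, $KC$ are perpendicular to the lines $VU$, $TV$, $TU$ at the points $A$, $B$, $C$, respectively (so that $A$ lies on line $VU$, $B$ lies on line $TV$, $C$ lies on line $TU$). Equivalently, $A$, $B$, $C$ are the orthogonal projections of $K$ onto the lines $VU$, $TV$, $TU$, respectively. Isogonal point: for the triangle $ABC$, a line $AD'$ is isogonal to a line $AD$ in the angle $\angle BAC$ if $AD'$ is the reflection of $AD$ in the bisector of $\angle BAC$; similarly at the vertices $B$ and $C$. If lines $AD$, $BE$, $CF$ meet at a point $K$ and their isogonals $AD'$, $BE'$, $CF'$ in the respective angles $\angle BAC$, $\angle ABC$, $\angle BCA$ concur in a point $K'$, then $K'$ is called the isogonal of $K$ for the triangle $ABC$. *)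

theory Defs
  imports "HOL-Analysis.Analysis"
begin

abbreviation line_through :: "real^2 \<Rightarrow> real^2 \<Rightarrow> (real^2) set" where
  "line_through X Y \<equiv> affine hull {X, Y}"

definition nondegenerate_triangle :: "real^2 \<Rightarrow> real^2 \<Rightarrow> real^2 \<Rightarrow> bool" where
  "nondegenerate_triangle X Y Z \<longleftrightarrow> \<not> collinear {X, Y, Z}"

definition triangle_area :: "real^2 \<Rightarrow> real^2 \<Rightarrow> real^2 \<Rightarrow> real" where
  "triangle_area X Y Z = measure lborel (convex hull {X, Y, Z})"

definition circumcircle :: "real^2 \<Rightarrow> real^2 \<Rightarrow> real^2 \<Rightarrow> real^2 \<Rightarrow> real \<Rightarrow> bool" where
  "circumcircle A B C M R \<longleftrightarrow> {A, B, C} \<subseteq> sphere M R"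

text \<open>The line \<open>KX\<close> is perpendicular to the line \<open>YZ\<close> at the point \<open>X\<close>. Both pairs of points
  have to be distinct for these to be lines.\<close>

definition perpendicular_at :: "real^2 \<Rightarrow> real^2 \<Rightarrow> real^2 \<Rightarrow> real^2 \<Rightarrow> bool" where
  "perpendicular_at K X Y Z \<longleftrightarrow>
     K \<noteq> X \<and> Y \<noteq> Z \<and> X \<in> line_through Y Z \<and> orthogonal (K - X) (Y - Z)"

definition antipedal_triangle ::
  "real^2 \<Rightarrow> real^2 \<Rightarrow> real^2 \<Rightarrow> real^2 \<Rightarrow> real^2 \<Rightarrow> real^2 \<Rightarrow> real^2 \<Rightarrow> bool" where
  "antipedal_triangle A B C K T U V \<longleftrightarrow>
     nondegenerate_triangle T U V \<and>
     perpendicular_at K A V U \<and> perpendicular_at K B T V \<and> perpendicular_at K C T U"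

definition reflect_in :: "(real^2) set \<Rightarrow> real^2 \<Rightarrow> real^2" where
  "reflect_in L P = 2 *\<^sub>R closest_point L P - P"

text \<open>The bisector of the angle \<open>YXZ\<close> at \<open>X\<close>, for noncollinear \<open>X\<close>, \<open>Y\<close>, \<open>Z\<close>: it is spanned by
  the diagonal of the rhombus whose sides are the unit vectors along the two arms of the angle.\<close>

definition angle_bisector :: "real^2 \<Rightarrow> real^2 \<Rightarrow> real^2 \<Rightarrow> (real^2) set" where
  "angle_bisector Y X Z = line_through X (X + sgn (Y - X) + sgn (Z - X))"

text \<open>The line \<open>XD'\<close> is isogonal to the line \<open>XD\<close> in the angle \<open>YXZ\<close>.\<close>

definition isogonal_in_angle ::
  "real^2 \<Rightarrow> real^2 \<Rightarrow> real^2 \<Rightarrow> real^2 \<Rightarrow> real^2 \<Rightarrow> bool" where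
  "isogonal_in_angle Y X Z D D' \<longleftrightarrow>
     D \<noteq> X \<and> D' \<noteq> X \<and>
     line_through X D' = reflect_in (angle_bisector Y X Z) ` line_through X D"

definition isogonal_point ::
  "real^2 \<Rightarrow> real^2 \<Rightarrow> real^2 \<Rightarrow> real^2 \<Rightarrow> real^2 \<Rightarrow> bool" where
  "isogonal_point A B C K K' \<longleftrightarrow>
     (\<exists>D E F D' E' F'.
        K \<in> line_through A D \<and> K \<in> line_through B E \<and> K \<in> line_through C F \<and>
        isogonal_in_angle B A C D D' \<and>
        isogonal_in_angle A B C E E' \<and>
        isogonal_in_angle B C A F F' \<and>
        K' \<in> line_through A D' \<and> K' \<in> line_through B E' \<and> K' \<in> line_through C F')"

end

theory Submission
  imports Defs
begin

text \<open>
  Everything is expressed in areal coordinates with respect to \<open>ABC\<close>. Let \<open>S\<close> be twice the signed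
  area of \<open>ABC\<close> and let \<open>x, y, z\<close> be twice the signed areas of \<open>KBC\<close>, \<open>AKC\<close>, \<open>ABK\<close>, so that
  \<open>x + y + z = S\<close>. With the side lengths \<open>a, b, c\<close>, put
  \<open>Q(K) = a\<^sup>2 y z + b\<^sup>2 z x + c\<^sup>2 x y\<close>. The circumcircle is the conic \<open>Q = 0\<close>, and more precisely
  \<open>Q(P) = S\<^sup>2 (R\<^sup>2 - MP\<^sup>2)\<close> for every point \<open>P\<close> (\<open>circle_power\<close>).

  Isogonal conjugation acts on these coordinates by \<open>x x' : y y' : z z' = a\<^sup>2 : b\<^sup>2 : c\<^sup>2\<close>,
  because reflection in the bisector of an angle exchanges the directions of its two arms.
  Substituting this into \<open>Q\<close> gives \<open>Q(K\<^sub>1) Q(K)\<^sup>2 = S\<^sup>3 a\<^sup>2 b\<^sup>2 c\<^sup>2 x y z\<close> (\<open>isogonal_circ_form\<close>).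

  The sides of the antipedal triangle are perpendicular to \<open>KA\<close>, \<open>KB\<close>, \<open>KC\<close>, so its area can be
  read off from their lengths and mutual wedge products, which are \<open>x, y, z\<close>. This gives
  \<open>[TUV] x y z S\<^sup>2 = Q(K)\<^sup>2\<close>, where \<open>[TUV]\<close> is twice the signed area, and it shows that
  \<open>x, y, z\<close> do not vanish when \<open>TUV\<close> is nondegenerate (\<open>antipedal_area2\<close>).

  Finally \<open>a b c = 2 R \<bar>S\<bar>\<close> (\<open>triangle_side_product\<close>). Eliminating \<open>Q(K)\<close> and \<open>x y z\<close> from these
  four relations leaves \<open>[TUV] (R\<^sup>2 - MK\<^sub>1\<^sup>2) = 4 R\<^sup>2 S\<close>, a signed form of the claim. In particular
  \<open>K\<^sub>1\<close> cannot lie on the circumcircle, so the denominator in the claim is nonzero.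
\<close>

section \<open>Signed areas\<close>

definition wedge :: "real^2 \<Rightarrow> real^2 \<Rightarrow> real" where
  "wedge u v = u$1 * v$2 - u$2 * v$1"

text \<open>Twice the signed area; the factor keeps all later identities polynomial.\<close>

definition area2 :: "real^2 \<Rightarrow> real^2 \<Rightarrow> real^2 \<Rightarrow> real" where
  "area2 X Y Z = wedge (Y - X) (Z - X)"

lemma inner_real2: "u \<bullet> v = u$1 * v$1 + u$2 * v$2" for u v :: "real^2"
  by (simp add: inner_vec_def sum_2)

lemma triangle_area_eq_area2: "triangle_area X Y Z = \<bar>area2 X Y Z\<bar> / 2"
  unfolding triangle_area_def area2_def wedge_def content_triangle
  by (simp add: algebra_simps)

text \<open>When \<open>u\<close> and \<open>v\<close> are parallel, \<open>v\<close> is its own orthogonal projection onto the span of \<open>u\<close>.\<close>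

lemma wedge_zero_imp_collinear:
  assumes "wedge u v = 0"
  shows "collinear {0, u, v}"
proof (cases "u = 0")
  case False
  have "v = ((u \<bullet> v) / (u \<bullet> u)) *\<^sub>R u"
  proof -
    have "(u \<bullet> u) *\<^sub>R v = (u \<bullet> v) *\<^sub>R u"
      using assms unfolding wedge_def vec_eq_iff forall_2 inner_real2
      by simp algebra
    then have "v = (1 / (u \<bullet> u)) *\<^sub>R ((u \<bullet> v) *\<^sub>R u)"
      using False by (metis divide_self_if inner_eq_zero_iff scaleR_one scaleR_scaleR
          times_divide_eq_left mult_1)
    then show ?thesis by simp
  qed
  then show ?thesis unfolding collinear_lemma by blast
qed (simp add: collinear_lemma)

lemma nondegenerate_triangle_area2_nonzero:
  assumes "nondegenerate_triangle X Y Z"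
  shows "area2 X Y Z \<noteq> 0"
proof
  assume "area2 X Y Z = 0"
  then have "collinear {0, Y - X, Z - X}"
    unfolding area2_def by (rule wedge_zero_imp_collinear)
  then have "collinear {Y, X, Z}"
    by (simp add: collinear_3)
  then show False
    using assms by (simp add: nondegenerate_triangle_def insert_commute)
qed

text \<open>In the plane, a vector \<open>r\<close> perpendicular to \<open>p\<close> is a multiple of \<open>p\<close> turned by a right angle,
  with factor \<open>wedge p r / (p \<bullet> p)\<close>, and turning both factors preserves the wedge product.\<close>

lemma wedge_perp_pair:
  assumes "r \<bullet> p = 0" "s \<bullet> q = 0"
  shows "(p \<bullet> p) * (q \<bullet> q) * wedge r s = wedge p r * wedge q s * wedge p q"
  using assms unfolding wedge_def inner_real2 by algebra

section \<open>The circumcircle in areal coordinates\<close>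

text \<open>The classical \<open>abc = 4R \<cdot> area\<close>, squared. With \<open>m = M - A\<close>, the equal distances give
  \<open>2 m \<bullet> u = u \<bullet> u\<close> and \<open>2 m \<bullet> v = v \<bullet> v\<close> for the sides \<open>u, v\<close> at \<open>A\<close>, and the norm of a vector of the
  plane is determined by its inner products with two others.\<close>

lemma triangle_side_product:
  assumes "dist A M = R" "dist B M = R" "dist C M = R"
  shows "(dist B C)\<^sup>2 * (dist C A)\<^sup>2 * (dist A B)\<^sup>2 = 4 * R\<^sup>2 * (area2 A B C)\<^sup>2"
proof -
  define u v m where "u = B - A" and "v = C - A" and "m = M - A"
  have d: "(dist B C)\<^sup>2 = u \<bullet> u - 2 * (u \<bullet> v) + v \<bullet> v" "(dist C A)\<^sup>2 = v \<bullet> v" "(dist A B)\<^sup>2 = u \<bullet> u"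
    "(dist A M)\<^sup>2 = m \<bullet> m" "(dist B M)\<^sup>2 = (u - m) \<bullet> (u - m)" "(dist C M)\<^sup>2 = (v - m) \<bullet> (v - m)"
    unfolding u_def v_def m_def
    by (auto simp: dist_norm power2_norm_eq_inner inner_diff inner_commute)
  note R = d(4-6)[unfolded assms]
  have u: "2 * (m \<bullet> u) = u \<bullet> u" and v: "2 * (m \<bullet> v) = v \<bullet> v"
    using R by (auto simp: inner_diff inner_commute)
  \<comment> \<open>Cramer's rule: \<open>m\<close> times \<open>wedge u v\<close> is \<open>(m \<bullet> u) v - (m \<bullet> v) u\<close> up to a quarter turn.\<close>
  have "(m \<bullet> m) * (wedge u v)\<^sup>2 =
      (m \<bullet> u)\<^sup>2 * (v \<bullet> v) - 2 * (m \<bullet> u) * (m \<bullet> v) * (u \<bullet> v) + (m \<bullet> v)\<^sup>2 * (u \<bullet> u)"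
    unfolding wedge_def inner_real2 by algebra
  then have "R\<^sup>2 * (wedge u v)\<^sup>2 * 4 =
      (2 * (m \<bullet> u))\<^sup>2 * (v \<bullet> v) - 2 * (2 * (m \<bullet> u)) * (2 * (m \<bullet> v)) * (u \<bullet> v)
      + (2 * (m \<bullet> v))\<^sup>2 * (u \<bullet> u)"
    unfolding R(1) by (simp add: power_mult_distrib)
  then have "R\<^sup>2 * (wedge u v)\<^sup>2 * 4 =
      (u \<bullet> u)\<^sup>2 * (v \<bullet> v) - 2 * (u \<bullet> u) * (v \<bullet> v) * (u \<bullet> v) + (v \<bullet> v)\<^sup>2 * (u \<bullet> u)"
    unfolding u v .
  then show ?thesis
    unfolding area2_def d(1-3) u_def[symmetric] v_def[symmetric] by algebra
qed

text \<open>The quadratic form in areal coordinates whose zero set is the circumcircle of \<open>ABC\<close>.\<close>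

definition circ_form :: "real^2 \<Rightarrow> real^2 \<Rightarrow> real^2 \<Rightarrow> real^2 \<Rightarrow> real" where
  "circ_form A B C P = (dist B C)\<^sup>2 * area2 A P C * area2 A B P
     + (dist C A)\<^sup>2 * area2 A B P * area2 P B C + (dist A B)\<^sup>2 * area2 P B C * area2 A P C"

lemma area2_split: "area2 P B C + area2 A P C + area2 A B P = area2 A B C"
  unfolding area2_def wedge_def by simp algebra

lemma area2_barycentric:
  "area2 P B C *\<^sub>R (A - P) + area2 A P C *\<^sub>R (B - P) + area2 A B P *\<^sub>R (C - P) = 0"
  unfolding area2_def wedge_def vec_eq_iff forall_2 by simp algebra

text \<open>Take the inner product of the relation \<open>area2_barycentric\<close> with itself and replace each mixed
  product \<open>2 (A - P) \<bullet> (B - P)\<close> by \<open>PA\<^sup>2 + PB\<^sup>2 - AB\<^sup>2\<close>.\<close>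

lemma weighted_square_sum:
  "area2 A B C * (area2 P B C * (dist A P)\<^sup>2 + area2 A P C * (dist B P)\<^sup>2 + area2 A B P * (dist C P)\<^sup>2)
   = circ_form A B C P"
proof -
  define x y z a b c where "x = area2 P B C" "y = area2 A P C" "z = area2 A B P"
    "a = A - P" "b = B - P" "c = C - P"
  note defs = this
  have 0: "x *\<^sub>R a + y *\<^sub>R b + z *\<^sub>R c = 0" 
    unfolding defs by (rule area2_barycentric)
  have "(x *\<^sub>R a + y *\<^sub>R b + z *\<^sub>R c) \<bullet> (x *\<^sub>R a + y *\<^sub>R b + z *\<^sub>R c) = 0"
    unfolding 0 by simp
  then have "x\<^sup>2 * (a \<bullet> a) + y\<^sup>2 * (b \<bullet> b) + z\<^sup>2 * (c \<bullet> c)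
      + 2 * x * y * (a \<bullet> b) + 2 * y * z * (b \<bullet> c) + 2 * x * z * (a \<bullet> c) = 0"
    by (simp add: inner_add inner_commute algebra_simps power2_eq_square)
  moreover have "(dist B C)\<^sup>2 = b \<bullet> b - 2 * (b \<bullet> c) + c \<bullet> c" "(dist C A)\<^sup>2 = c \<bullet> c - 2 * (a \<bullet> c) + a \<bullet> a"
     "(dist A B)\<^sup>2 = a \<bullet> a - 2 * (a \<bullet> b) + b \<bullet> b" "(dist A P)\<^sup>2 = a \<bullet> a" "(dist B P)\<^sup>2 = b \<bullet> b"
     "(dist C P)\<^sup>2 = c \<bullet> c"
    unfolding defs by (auto simp: dist_norm power2_norm_eq_inner inner_diff inner_commute)
  moreover have "area2 A B C = x + y + z"
    unfolding defs by (simp add: area2_split)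
  ultimately show ?thesis
    unfolding circ_form_def defs(1-3)[symmetric] by algebra
qed

text \<open>The power of \<open>P\<close> equals \<open>2 (A - P) \<bullet> (M - P) - PA\<^sup>2\<close>, and likewise for \<open>B\<close> and \<open>C\<close>. In the
  average of these expressions weighted by the areal coordinates of \<open>P\<close>, the inner products
  with \<open>M - P\<close> cancel, and what remains is the sum in \<open>weighted_square_sum\<close>.\<close>

lemma circle_power:
  assumes "dist A M = R" "dist B M = R" "dist C M = R"
  shows "(area2 A B C)\<^sup>2 * (R\<^sup>2 - (dist M P)\<^sup>2) = circ_form A B C P"
proof -
  define x y z a b c m where "x = area2 P B C" "y = area2 A P C" "z = area2 A B P"
    "a = A - P" "b = B - P" "c = C - P" "m = M - P"
  note defs = this
  define w where "w = R\<^sup>2 - (dist M P)\<^sup>2"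
  have "(dist A M)\<^sup>2 = (a - m) \<bullet> (a - m)" "(dist B M)\<^sup>2 = (b - m) \<bullet> (b - m)"
     "(dist C M)\<^sup>2 = (c - m) \<bullet> (c - m)" "(dist M P)\<^sup>2 = m \<bullet> m"
    unfolding defs by (auto simp: dist_norm power2_norm_eq_inner)
  then have R: "a \<bullet> a = w + 2 * (a \<bullet> m)" "b \<bullet> b = w + 2 * (b \<bullet> m)" "c \<bullet> c = w + 2 * (c \<bullet> m)"
    unfolding w_def assms by (auto simp: inner_diff inner_commute)
  have d: "(dist A P)\<^sup>2 = a \<bullet> a" "(dist B P)\<^sup>2 = b \<bullet> b" "(dist C P)\<^sup>2 = c \<bullet> c"
    unfolding defs by (auto simp: dist_norm power2_norm_eq_inner)
  have "x * (a \<bullet> a) + y * (b \<bullet> b) + z * (c \<bullet> c)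
      = (x + y + z) * w + 2 * ((x *\<^sub>R a + y *\<^sub>R b + z *\<^sub>R c) \<bullet> m)"
    unfolding R by (simp add: inner_add algebra_simps)
  also have "x *\<^sub>R a + y *\<^sub>R b + z *\<^sub>R c = 0"
    unfolding defs by (rule area2_barycentric)
  also have "x + y + z = area2 A B C"
    unfolding defs by (rule area2_split)
  finally have "area2 A B C * (x * (a \<bullet> a) + y * (b \<bullet> b) + z * (c \<bullet> c)) = (area2 A B C)\<^sup>2 * w"
    by (simp add: power2_eq_square)
  then show ?thesis
    unfolding w_def[symmetric] d[symmetric] unfolding defs(1-3) weighted_square_sum by simp
qed

section \<open>Isogonal conjugation in areal coordinates\<close>

lemma mem_line_through_iff: "P \<in> line_through X Y \<longleftrightarrow> (\<exists>t. P = X + t *\<^sub>R (Y - X))"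
proof -
  have "P \<in> line_through X Y \<longleftrightarrow> (\<exists>u v. P = u *\<^sub>R X + v *\<^sub>R Y \<and> u + v = 1)"
    by (auto simp: affine_hull_2)
  also have "\<dots> \<longleftrightarrow> (\<exists>t. P = (1 - t) *\<^sub>R X + t *\<^sub>R Y)"
    by (metis add_diff_cancel_right' diff_add_cancel)
  finally show ?thesis by (simp add: algebra_simps)
qed

lemma closest_point_line_through:
  assumes "w \<noteq> 0"
  shows "closest_point (line_through X (X + w)) P = X + (((P - X) \<bullet> w) / (w \<bullet> w)) *\<^sub>R w"
    (is "_ = ?F")
proof (rule closest_point_unique[symmetric])
  show "convex (line_through X (X + w))" "closed (line_through X (X + w))"
    by (auto simp: affine_imp_convex)
  show "?F \<in> line_through X (X + w)"
    unfolding mem_line_through_iff by auto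
  show "\<forall>Q\<in>line_through X (X + w). dist P ?F \<le> dist P Q"
  proof
    fix Q assume "Q \<in> line_through X (X + w)"
    then obtain t where Q: "Q = X + t *\<^sub>R w"
      unfolding mem_line_through_iff by auto
    define s where "s = ((P - X) \<bullet> w) / (w \<bullet> w) - t"
    have s: "?F - Q = s *\<^sub>R w"
      unfolding Q s_def by (simp add: scaleR_left_diff_distrib)
    have "(P - ?F) \<bullet> w = 0"
      using assms by (simp add: inner_diff inner_add)
    then have "orthogonal (P - ?F) (s *\<^sub>R w)"
      by (simp add: orthogonal_def)
    then have "(norm ((P - ?F) + s *\<^sub>R w))\<^sup>2 = (norm (P - ?F))\<^sup>2 + (norm (s *\<^sub>R w))\<^sup>2"
      by (rule norm_add_Pythagorean)
    also have "(P - ?F) + s *\<^sub>R w = P - Q"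
      unfolding s[symmetric] by simp
    finally have "(norm (P - ?F))\<^sup>2 \<le> (norm (P - Q))\<^sup>2"
      by (metis le_add_same_cancel1 zero_le_power2)
    then show "dist P ?F \<le> dist P Q"
      unfolding dist_norm by (rule power2_le_imp_le) (rule norm_ge_zero)
  qed
qed

text \<open>The vector \<open>q\<close> is the image of \<open>p\<close> under the reflection in the line spanned by \<open>e + f\<close>. This
  reflection exchanges the unit vectors \<open>e\<close> and \<open>f\<close> and reverses orientation, so it takes
  \<open>wedge p f\<close> to \<open>- wedge q e\<close>.\<close>

lemma unit_bisector_reflection_wedge:
  fixes e f p :: "real^2"
  assumes "e \<bullet> e = 1" "f \<bullet> f = 1" "e + f \<noteq> 0"
  defines "w \<equiv> e + f"
  defines "q \<equiv> (2 * (p \<bullet> w) / (w \<bullet> w)) *\<^sub>R w - p"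
  shows "wedge e q = wedge p f" "wedge q f = wedge e p"
proof -
  have w: "w \<bullet> w = 2 * (1 + e \<bullet> f)"
    using assms(1,2) unfolding w_def by (simp add: inner_add inner_commute)
  have "w \<bullet> w \<noteq> 0" using assms(3) unfolding w_def by simp
  then have nz: "1 + e \<bullet> f \<noteq> 0" unfolding w by simp
  \<comment> \<open>The linear relation between \<open>e\<close>, \<open>f\<close>, \<open>p\<close>, paired with \<open>e\<close> and with \<open>f\<close>.\<close>
  have "(p \<bullet> e) * wedge e f = (e \<bullet> e) * wedge p f + (e \<bullet> f) * wedge e p"
       "(p \<bullet> f) * wedge e f = (f \<bullet> f) * wedge e p + (e \<bullet> f) * wedge p f"
    unfolding wedge_def inner_real2 by algebra+
  then have key: "(p \<bullet> w) * wedge e f = (1 + e \<bullet> f) * (wedge p f + wedge e p)"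
    unfolding w_def assms(1,2) by (simp add: inner_add algebra_simps)
  have "2 * (p \<bullet> w) / (w \<bullet> w) * wedge e f = wedge p f + wedge e p"
    unfolding w using key nz by (simp add: field_simps)
  moreover have "wedge e (k *\<^sub>R (e + f) - p) = k * wedge e f - wedge e p"
    "wedge (k *\<^sub>R (e + f) - p) f = k * wedge e f - wedge p f" for k
    by (simp_all add: wedge_def algebra_simps)
  then have "wedge e q = 2 * (p \<bullet> w) / (w \<bullet> w) * wedge e f - wedge e p"
    "wedge q f = 2 * (p \<bullet> w) / (w \<bullet> w) * wedge e f - wedge p f"
    unfolding q_def w_def by blast+
  ultimately show "wedge e q = wedge p f" "wedge q f = wedge e p"
    by simp_all
qed

text \<open>Isogonality in one angle says that the ratio of the two areal coordinates belonging to the arms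
  is inverted, up to the ratio of the squared lengths of the arms: reflection in the bisector
  exchanges the distances to the two arms, and area is distance times length of the arm.\<close>

lemma isogonal_in_angle_wedge:
  assumes "area2 X Y Z \<noteq> 0" "isogonal_in_angle Y X Z D D'"
    and "K \<noteq> X" "K \<in> line_through X D" "K' \<in> line_through X D'"
  shows "area2 X Y K * area2 X Y K' * (dist X Z)\<^sup>2 = area2 X K Z * area2 X K' Z * (dist X Y)\<^sup>2"
proof -
  define e f w where "e = sgn (Y - X)" "f = sgn (Z - X)" "w = e + f"
  note defs = this
  have ne: "Y \<noteq> X" "Z \<noteq> X"
    using assms(1) by (auto simp: area2_def wedge_def)
  have Y: "Y - X = dist X Y *\<^sub>R e" and Z: "Z - X = dist X Z *\<^sub>R f"
    using ne by (auto simp: defs sgn_div_norm dist_norm norm_minus_commute)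
  have unit: "e \<bullet> e = 1" "f \<bullet> f = 1"
    using ne by (auto simp: defs norm_sgn simp flip: power2_norm_eq_inner)
  have "w \<noteq> 0"
  proof
    assume "w = 0"
    then have "f = - e" by (simp add: defs(3) add_eq_0_iff)
    then have "area2 X Y Z = 0"
      unfolding area2_def Y Z by (simp add: wedge_def)
    then show False using assms(1) by simp
  qed
  obtain P where P: "P \<in> line_through X D" "K' = reflect_in (line_through X (X + w)) P"
    using assms(2,5) unfolding isogonal_in_angle_def angle_bisector_def defs
    by (auto simp: add.assoc)
  obtain s where s: "K = X + s *\<^sub>R (D - X)" using assms(4) mem_line_through_iff by blast
  obtain r where r: "P = X + r *\<^sub>R (D - X)" using P(1) mem_line_through_iff by blast
  define p where "p = K - X"
  define q where "q = (2 * (p \<bullet> w) / (w \<bullet> w)) *\<^sub>R w - p"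
  define t where "t = r / s"
  have "s \<noteq> 0" using assms(3) s by auto
  then have t: "P - X = t *\<^sub>R p"
    unfolding p_def s r t_def by simp
  have "K' - X = 2 *\<^sub>R (X + (((P - X) \<bullet> w) / (w \<bullet> w)) *\<^sub>R w) - P - X"
    unfolding P(2) reflect_in_def closest_point_line_through[OF \<open>w \<noteq> 0\<close>] by simp
  also have "\<dots> = (2 * (((P - X) \<bullet> w) / (w \<bullet> w))) *\<^sub>R w - (P - X)"
    by (simp add: scaleR_add_right algebra_simps scaleR_2)
  also have "\<dots> = t *\<^sub>R q"
    unfolding t q_def by (simp add: algebra_simps)
  finally have K': "K' - X = t *\<^sub>R q" .
  have wq: "wedge e q = wedge p f" "wedge q f = wedge e p"
    using unit_bisector_reflection_wedge[OF unit, of p] \<open>w \<noteq> 0\<close> unfolding q_def defs(3) by auto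
  have wedge_scale: "wedge (a *\<^sub>R u) v = a * wedge u v" "wedge u (a *\<^sub>R v) = a * wedge u v" for a u v
    by (simp_all add: wedge_def algebra_simps)
  show ?thesis
    unfolding area2_def Y Z K' p_def[symmetric] wedge_scale wq by algebra
qed

text \<open>Isogonality at two vertices yields \<open>x x' = l a\<^sup>2\<close>, \<open>y y' = l b\<^sup>2\<close>, \<open>z z' = l c\<^sup>2\<close> for some \<open>l\<close>. Clearing
  denominators in \<open>x' = l a\<^sup>2 / x\<close> and its analogues turns \<open>x' + y' + z' = S\<close> into
  \<open>x y z S = l Q(K)\<close>, and turns \<open>Q(K')\<close> into \<open>l\<^sup>2 a\<^sup>2 b\<^sup>2 c\<^sup>2 S / (x y z)\<close>. Eliminating \<open>l\<close> gives the claim.\<close>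

lemma isogonal_circ_form:
  assumes S: "area2 A B C \<noteq> 0" and iso: "isogonal_point A B C K K'"
    and ne: "K \<noteq> A" "K \<noteq> B" "K \<noteq> C"
    and xyz: "area2 K B C \<noteq> 0" "area2 A K C \<noteq> 0" "area2 A B K \<noteq> 0"
  shows "circ_form A B C K' * (circ_form A B C K)\<^sup>2 =
    (area2 A B C)^3 * ((dist B C)\<^sup>2 * (dist C A)\<^sup>2 * (dist A B)\<^sup>2)
      * (area2 K B C * area2 A K C * area2 A B K)"
proof -
  define x y z x' y' z' where "x = area2 K B C" "y = area2 A K C" "z = area2 A B K"
    "x' = area2 K' B C" "y' = area2 A K' C" "z' = area2 A B K'"
  note defs = this
  \<comment> \<open>Here \<open>a\<close>, \<open>b\<close>, \<open>c\<close> stand for the squared side lengths.\<close>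
  define a b c where "a = (dist B C)\<^sup>2" "b = (dist C A)\<^sup>2" "c = (dist A B)\<^sup>2"
  note sides = this
  have flip: "area2 B A P = - area2 A B P" "area2 B P C = - area2 P B C" for P
    by (simp_all add: area2_def wedge_def algebra_simps)
  have S': "area2 B A C \<noteq> 0" using S by (simp add: flip)
  obtain D E D' E' where DE: "isogonal_in_angle B A C D D'" "K \<in> line_through A D" "K' \<in> line_through A D'"
    "isogonal_in_angle A B C E E'" "K \<in> line_through B E" "K' \<in> line_through B E'"
    using iso unfolding isogonal_point_def by blast
  have A: "z * z' * b = y * y' * c"
    using isogonal_in_angle_wedge[OF S DE(1) ne(1) DE(2,3)]
    unfolding defs sides by (simp add: dist_commute)
  have B: "z * z' * a = x * x' * c"
    using isogonal_in_angle_wedge[OF S' DE(4) ne(2) DE(5,6)]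
    unfolding defs sides by (simp add: dist_commute flip)
  have "c \<noteq> 0" using S by (auto simp: sides area2_def wedge_def)
  define l where "l = z * z' / c"
  have l: "z * z' = l * c" "y * y' = l * b" "x * x' = l * a"
    using A B \<open>c \<noteq> 0\<close> unfolding l_def by (auto simp: field_simps)
  define Q Q' where "Q = circ_form A B C K" "Q' = circ_form A B C K'"
  have Q: "Q = a * y * z + b * z * x + c * x * y" "Q' = a * y' * z' + b * z' * x' + c * x' * y'"
    unfolding Q_Q'_def circ_form_def defs sides by simp_all
  have sum: "x + y + z = area2 A B C" "x' + y' + z' = area2 A B C"
    unfolding defs by (simp_all add: area2_split)
  have "x * y * z * area2 A B C = (x * x') * (y * z) + (y * y') * (z * x) + (z * z') * (x * y)"
    unfolding sum(2)[symmetric] by (simp add: algebra_simps)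
  then have 1: "x * y * z * area2 A B C = l * Q"
    unfolding l Q by (simp add: algebra_simps)
  have "x * y * z * Q' = a * x * ((y * y') * (z * z')) + b * y * ((z * z') * (x * x'))
      + c * z * ((x * x') * (y * y'))"
    unfolding Q by (simp add: algebra_simps)
  then have 2: "x * y * z * Q' = l\<^sup>2 * (a * b * c) * area2 A B C"
    unfolding l sum(1)[symmetric] by (simp add: algebra_simps power2_eq_square)
  have "(x * y * z) * (Q' * Q\<^sup>2) = (l * Q)\<^sup>2 * (a * b * c) * area2 A B C"
    using 2 by (simp add: power_mult_distrib mult.assoc[symmetric])
  also have "\<dots> = (x * y * z) * (area2 A B C ^ 3 * (a * b * c) * (x * y * z))"
    unfolding 1[symmetric] by (simp add: power2_eq_square power3_eq_cube)
  finally have "(x * y * z) * (Q' * Q\<^sup>2) = (x * y * z) * (area2 A B C ^ 3 * (a * b * c) * (x * y * z))" .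
  then show ?thesis
    using xyz unfolding defs(1-3)[symmetric] sides[symmetric] Q_Q'_def[symmetric] by simp
qed

section \<open>The area of the antipedal triangle\<close>

lemma perpendicular_at_foot:
  assumes "perpendicular_at K X Y Z"
  shows "(X - K) \<bullet> (Y - X) = 0" "(X - K) \<bullet> (Z - X) = 0" "K \<noteq> X"
proof -
  obtain t where t: "X = Y + t *\<^sub>R (Z - Y)"
    using assms unfolding perpendicular_at_def mem_line_through_iff by blast
  have "Y - X = t *\<^sub>R (Y - Z)" "Z - X = (t - 1) *\<^sub>R (Y - Z)"
    unfolding t by (simp_all add: algebra_simps)
  moreover have "(X - K) \<bullet> (Y - Z) = 0"
    using assms unfolding perpendicular_at_def orthogonal_def by (simp add: inner_diff)
  ultimately show "(X - K) \<bullet> (Y - X) = 0" "(X - K) \<bullet> (Z - X) = 0"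
    by simp_all
  show "K \<noteq> X" using assms by (simp add: perpendicular_at_def)
qed

text \<open>If \<open>q\<close> is perpendicular to \<open>r\<close>, then \<open>(p \<bullet> r) q\<close> is \<open>wedge p q\<close> times \<open>r\<close> turned by a right angle.
  This is the wedge product of two such relations. It recovers \<open>wedge r s\<close> from the directions
  of the normals \<open>q\<close>, \<open>q'\<close> and the extents of \<open>r\<close> and \<open>s\<close> along a third direction \<open>p\<close>.\<close>

lemma wedge_perp_scale:
  assumes "q \<bullet> r = 0" "q' \<bullet> s = 0"
  shows "(p \<bullet> r) * (p \<bullet> s) * wedge q q' = wedge p q * wedge p q' * wedge r s"
  using assms unfolding wedge_def inner_real2 by algebra

lemma wedge_nonzero_of_perp:
  assumes "r \<bullet> p = 0" "s \<bullet> q = 0" "p \<noteq> 0" "q \<noteq> 0" "wedge r s \<noteq> 0"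
  shows "wedge p q \<noteq> 0"
  using wedge_perp_pair[OF assms(1,2)] assms(3-5) by auto

text \<open>Write \<open>a, b, c\<close> for the vectors from \<open>K\<close> to \<open>A, B, C\<close>. Then \<open>x, y, z\<close> are the wedge products of
  pairs of them, so \<open>x = 0\<close> would make two sides of \<open>TUV\<close> parallel. The inner product of
  \<open>x a + y b + z c = 0\<close> with \<open>T - K\<close> determines the distance of \<open>T\<close> from the side \<open>UV\<close>:
  \<open>x a \<bullet> (U - T) = x a \<bullet> (V - T) = N\<close>, where \<open>N\<close> is the sum in \<open>weighted_square_sum\<close>. Since the sides at
  \<open>T\<close> are perpendicular to \<open>b\<close> and \<open>c\<close>, this and \<open>wedge_perp_scale\<close> give the area.\<close>

lemma antipedal_area2:
  assumes "antipedal_triangle A B C K T U V"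
  shows "area2 K B C \<noteq> 0" "area2 A K C \<noteq> 0" "area2 A B K \<noteq> 0"
    and "area2 T U V * (area2 K B C * area2 A K C * area2 A B K) * (area2 A B C)\<^sup>2 = (circ_form A B C K)\<^sup>2"
proof -
  define x y z a b c where "x = area2 K B C" "y = area2 A K C" "z = area2 A B K"
    "a = A - K" "b = B - K" "c = C - K"
  note defs = this
  have perp: "perpendicular_at K A V U" "perpendicular_at K B T V" "perpendicular_at K C T U"
    and TUV: "area2 T U V \<noteq> 0"
    using assms nondegenerate_triangle_area2_nonzero by (auto simp: antipedal_triangle_def)
  note foot = perpendicular_at_foot[OF perp(1)] perpendicular_at_foot[OF perp(2)]
    perpendicular_at_foot[OF perp(3)]
  have ne: "a \<noteq> 0" "b \<noteq> 0" "c \<noteq> 0" using foot by (auto simp: defs)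
  have inn: "a \<bullet> (U - K) = a \<bullet> a" "a \<bullet> (V - K) = a \<bullet> a" "b \<bullet> (T - K) = b \<bullet> b"
    "b \<bullet> (V - K) = b \<bullet> b" "c \<bullet> (T - K) = c \<bullet> c" "c \<bullet> (U - K) = c \<bullet> c"
    using foot unfolding defs by (auto simp: inner_diff)
  have side: "(V - U) \<bullet> a = 0" "(T - V) \<bullet> b = 0" "(U - T) \<bullet> c = 0"
    using inn by (auto simp: inner_diff inner_commute)
  have w: "wedge b c = x" "wedge c a = y" "wedge a b = z"
    unfolding defs area2_def wedge_def by (simp_all add: algebra_simps)
  have "wedge (T - V) (U - T) \<noteq> 0" "wedge (U - T) (V - U) \<noteq> 0" "wedge (V - U) (T - V) \<noteq> 0"
    using TUV by (simp_all add: area2_def wedge_def algebra_simps)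
  then show xyz: "area2 K B C \<noteq> 0" "area2 A K C \<noteq> 0" "area2 A B K \<noteq> 0"
    using wedge_nonzero_of_perp side ne unfolding defs(1-3)[symmetric] w[symmetric] by blast+
  define N where "N = x * (a \<bullet> a) + y * (b \<bullet> b) + z * (c \<bullet> c)"
  have "(x *\<^sub>R a + y *\<^sub>R b + z *\<^sub>R c) \<bullet> (T - K) = 0"
    unfolding defs area2_barycentric by simp
  then have "x * (a \<bullet> (T - K)) + y * (b \<bullet> b) + z * (c \<bullet> c) = 0"
    unfolding inner_add_left inner_scaleR_left inn .
  then have "x * (a \<bullet> a - a \<bullet> (T - K)) = N"
    unfolding N_def right_diff_distrib by linarith
  moreover have "a \<bullet> (U - T) = a \<bullet> a - a \<bullet> (T - K)" "a \<bullet> (V - T) = a \<bullet> a - a \<bullet> (T - K)"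
    using inn(1,2) by (simp_all add: inner_diff)
  ultimately have xa: "x * (a \<bullet> (U - T)) = N" "x * (a \<bullet> (V - T)) = N"
    by simp_all
  have "(a \<bullet> (U - T)) * (a \<bullet> (V - T)) * wedge c b = wedge a c * wedge a b * wedge (U - T) (V - T)"
    using side by (intro wedge_perp_scale) (auto simp: inner_diff inner_commute)
  moreover have "wedge c b = - x" "wedge a c = - y"
    using w by (auto simp: wedge_def)
  ultimately have "(a \<bullet> (U - T)) * (a \<bullet> (V - T)) * x = y * z * area2 T U V"
    unfolding w area2_def by simp
  then have "x * N\<^sup>2 = x * (area2 T U V * (x * y * z))"
    using xa by algebra
  then have N2: "N\<^sup>2 = area2 T U V * (x * y * z)"
    using xyz unfolding defs(1) by simp
  have "circ_form A B C K = area2 A B C * N"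
    unfolding weighted_square_sum[symmetric] N_def defs
    by (simp add: dist_norm power2_norm_eq_inner)
  then show "area2 T U V * (area2 K B C * area2 A K C * area2 A B K) * (area2 A B C)\<^sup>2
      = (circ_form A B C K)\<^sup>2"
    using N2 unfolding defs(1-3) by (simp add: power_mult_distrib)
qed

theorem theorem1p4:
  fixes A B C M K T U V K1 :: "real^2" and R :: real
  assumes "nondegenerate_triangle A B C"
    and "circumcircle A B C M R"
    and "antipedal_triangle A B C K T U V"
    and "isogonal_point A B C K K1"
  shows "triangle_area T U V / triangle_area A B C = 4 * R^2 / \<bar>R^2 - (dist M K1)^2\<bar>"
proof -
  define S D p Q Q1 w where "S = area2 A B C" "D = area2 T U V"
    "p = area2 K B C * area2 A K C * area2 A B K"
    "Q = circ_form A B C K" "Q1 = circ_form A B C K1" "w = R\<^sup>2 - (dist M K1)\<^sup>2"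
  note defs = this
  have S: "S \<noteq> 0"
    using assms(1) nondegenerate_triangle_area2_nonzero by (simp add: defs)
  have circ: "dist A M = R" "dist B M = R" "dist C M = R"
    using assms(2) by (auto simp: circumcircle_def dist_commute)
  have K: "K \<noteq> A" "K \<noteq> B" "K \<noteq> C"
    using assms(3) by (auto simp: antipedal_triangle_def perpendicular_at_def)
  have "R \<noteq> 0"
    using circ S by (auto simp: defs(1) area2_def wedge_def)
  note anti = antipedal_area2[OF assms(3)]
  have p: "p \<noteq> 0" using anti unfolding defs by simp
  have DQ: "D * p * S\<^sup>2 = Q\<^sup>2"
    using anti unfolding defs by simp
  have "Q1 * Q\<^sup>2 = S ^ 3 * (4 * R\<^sup>2 * S\<^sup>2) * p"
    using isogonal_circ_form[OF _ assms(4) K anti(1-3)] S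
    unfolding triangle_side_product[OF circ] unfolding defs by blast
  moreover have "S\<^sup>2 * w = Q1"
    using circle_power[OF circ] unfolding defs .
  \<comment> \<open>Both sides carry the nonzero factor \<open>p S\<^sup>4\<close> once \<open>Q\<^sup>2\<close> is replaced by \<open>D p S\<^sup>2\<close>.\<close>
  ultimately have "(p * S ^ 4) * (D * w) = (p * S ^ 4) * (4 * R\<^sup>2 * S)"
    unfolding DQ[symmetric] by algebra
  then have Dw: "D * w = 4 * R\<^sup>2 * S"
    using p S by simp
  then have "w \<noteq> 0" using S \<open>R \<noteq> 0\<close> by auto
  have "\<bar>D\<bar> * \<bar>w\<bar> = 4 * R\<^sup>2 * \<bar>S\<bar>"
    using arg_cong[OF Dw, of abs] by (simp add: abs_mult)
  then show ?thesis
    unfolding triangle_area_eq_area2 defs(1,2,6)[symmetric]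
    using S \<open>w \<noteq> 0\<close> by (simp add: field_simps)
qed

end
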